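(* Let $\mathbb{P}$ be the power-set monad and $\beta$ the ultrafilter monad on $\mathbf{Set}$, and let $\delta \colon \beta P \Rightarrow P\beta$ be the canonical weak distributive law of $\mathbb{P}$ over $\beta$. Under Manes' identification of the category $\mathbf{Set}^{\beta}$ of $\beta$-algebras with the category $\mathbf{KHaus}$ of compact Hausdorff spaces and continuous maps, the weak lifting of $\mathbb{P}$ to $\mathbf{Set}^{\beta}$ associated to $\delta$ is the Vietoris monad $\mathbb{V}$ on $\mathbf{KHaus}$.
   Context: **Power-set monad $\mathbb{P}$ on $\mathbf{Set}$.** $PX$ is the set of all subsets of $X$; $Pf$ is direct image; the unit is $x \mapsto \{x\}$; the multiplication $PPX \to PX$ is $\mathcal{A} \mapsto \bigcup \mathcal{A}$. **Ultrafilter monad $\beta$ on $\mathbf{Set}$.** $\beta X$ is the set of ultrafilters on $X$; for $f \colon X \to Y$, $\beta f(\mathcal{F}) = \{B \subseteq Y : f^{-1}(B) \in \mathcal{F}\}$; the unit is $\eta_X(x) = \{A \subseteq X : x \in A\}$; the multiplication is $\mu_X(\mathbf{F}) = \{A \subseteq X : A^\# \in \mathbf{F}\}$, where $A^\# = \{\mathcal{F} \in \beta X : A \in \mathcal{F}\}$. By Manes' theorem, $\mathbf{Set}^\beta$ is identified with $\mathbf{KHaus}$: a compact Hausdorff space $X$ corresponds to the algebra $\xi \colon \beta X \to X$ sending each ultrafilter to its unique point of convergence, and algebra maps are the continuous maps. **Vietoris monad $\mathbb{V}$ on $\mathbf{KHaus}$.** $VX$ is the set of all closed subsets of $X$ with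 the topology generated by the subbasic open sets $C^+ = \{A \in VX : A \cap C = \emptyset\}$ and $C^- = \{A \in VX : A \nsubseteq C\}$ for $C \in VX$; $Vf$ is direct image; the unit is $x \mapsto \{x\}$; the multiplication $VVX \to VX$ is $\mathcal{A} \mapsto \bigcup \mathcal{A}$. **Weak distributive laws.** For monads $\mathbb{S} = (S, \nu, \omega)$ and $\mathbb{T} = (T, \eta, \mu)$ on a category $\mathcal{C}$ (unit listed before multiplication), a weak distributive law of $\mathbb{S}$ over $\mathbb{T}$ is a natural transformation $\delta \colon TS \Rightarrow ST$ with $\delta \circ T\omega = \omega T \circ S\delta \circ \delta S$, $\delta \circ \mu S = S\mu \circ \delta T \circ T\delta$ and $\delta \circ T\nu = \nu T$ (no condition involving $\eta$). **The canonical weak distributive law of $\mathbb{P}$ over $\beta$.** The Kleisli category of $\mathbb{P}$ is the category $\mathbf{Rel}$ of sets and relations. The endofunctor and multiplication of $\beta$ are weakly cartesian, so $\beta$ has a canonical weak extension to $\mathbf{Rel}$, whose functor sends a relation $R \subseteq X \times Y$ to the relation $\tilde\beta R \subseteq \beta X \times \beta Y$ given by $\mathcal{F} \mathrel{\tilde\beta R} \mathcal{G}$ iff $R(A) \in \mathcal{G}$ for all $A \in \mathcal{F}$, where $R(A) = \{y : \exists a \in A,\ a \mathrel{R} y\}$. The corresponding weak distributive law, obtained by applying $\tilde\beta$ to the relations $\ni\ \subseteq PX \times X$, has components $\delta_X \colon \beta PX \to P\beta X$ given by $$\delta_X(\mathbf{F}) = \{\mathcal{F} \in \beta X : \textstyle\bigcup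 \mathcal{A} \in \mathcal{F} \text{ for all } \mathcal{A} \in \mathbf{F}\}.$$ **Weak liftings.** Write $U \colon \mathcal{C}^{\mathbb{T}} \to \mathcal{C}$ for the forgetful functor from the category of $\mathbb{T}$-algebras. A weak lifting of $\mathbb{S}$ to $\mathcal{C}^{\mathbb{T}}$ is a monad $\tilde{\mathbb{S}} = (\tilde S, \tilde\nu, \tilde\omega)$ on $\mathcal{C}^{\mathbb{T}}$ with natural transformations $\iota \colon U\tilde S \Rightarrow SU$ and $\pi \colon SU \Rightarrow U\tilde S$ such that $\pi\iota = 1$, $\iota \circ U\tilde\omega = \omega U \circ S\iota \circ \iota\tilde S$, $\iota \circ U\tilde\nu = \nu U$, $U\tilde\omega \circ \pi\tilde S \circ S\pi = \pi \circ \omega U$ and $\pi \circ \nu U = U\tilde\nu$. **The weak lifting associated to $\delta$** (when idempotents split in $\mathcal{C}$). A $\mathbb{T}$-semialgebra is a pair $(X, x \colon TX \to X)$ with $x \circ Tx = x \circ \mu_X$; a map $(X,x) \to (Y,y)$ is an $f \colon X \to Y$ with $y \circ Tf = f \circ x$. For a $\mathbb{T}$-algebra $(X,x)$, $(SX, Sx \circ \delta_X)$ is a semialgebra, and $Sx \circ \delta_X \circ \eta_{SX}$ is an idempotent semialgebra endomorphism of it; $\tilde S(X,x)$ is the $\mathbb{T}$-algebra obtained by splitting this idempotent among semialgebras, with $\pi_{X,x}$ and $\iota_{X,x}$ the two halves of the splitting. The action of $\tilde S$ on maps is determined by naturality of $\iota$ and $\pi$, and $\tilde\nu$, $\tilde\omega$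 are the unique maps satisfying the equations above. The associated weak lifting is thus determined up to the choice of splittings of idempotents; for an idempotent $e$ on a set one may take the splitting through the set of fixed points of $e$. *)

theory Defs
  imports "HOL-Analysis.Analysis"
begin

text \<open>
  A set is a subset \<open>A :: 'a set\<close> of an arbitrary type. Functors, units and multiplications are
  polymorphic constants that take the carrier of the component as an argument; maps are HOL
  functions of which only the values on the carrier matter. The power-set monad is rendered by
  \<^const>\<open>Pow\<close> on sets, image on maps, \<open>x \<mapsto> {x}\<close> and \<^const>\<open>Union\<close>.
\<close>

definition ultrafilter_on :: "'a set \<Rightarrow> 'a set set \<Rightarrow> bool" where
  "ultrafilter_on A F \<longleftrightarrow>
     F \<subseteq> Pow A \<and> A \<in> F \<and> {} \<notin> F \<and>
     (\<forall>S\<in>F. \<forall>T\<in>F. S \<inter> T \<in> F) \<and>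
     (\<forall>S\<in>F. \<forall>T. S \<subseteq> T \<and> T \<subseteq> A \<longrightarrow> T \<in> F) \<and>
     (\<forall>S. S \<subseteq> A \<longrightarrow> S \<in> F \<or> A - S \<in> F)"

definition beta :: "'a set \<Rightarrow> 'a set set set" where
  "beta A = {F. ultrafilter_on A F}"

definition beta_map :: "'a set \<Rightarrow> 'b set \<Rightarrow> ('a \<Rightarrow> 'b) \<Rightarrow> 'a set set \<Rightarrow> 'b set set" where
  "beta_map A B f F = {S. S \<subseteq> B \<and> {x\<in>A. f x \<in> S} \<in> F}"

definition beta_unit :: "'a set \<Rightarrow> 'a \<Rightarrow> 'a set set" where
  "beta_unit A x = {S. S \<subseteq> A \<and> x \<in> S}"

definition beta_mult :: "'a set \<Rightarrow> 'a set set set set \<Rightarrow> 'a set set" where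
  "beta_mult A FF = {S. S \<subseteq> A \<and> {F \<in> beta A. S \<in> F} \<in> FF}"

text \<open>
  \<open>beta_rel\<close> is the weak extension of the ultrafilter monad to relations; the canonical weak
  distributive law \<open>delta\<close> is its value at the converse membership relations.
\<close>

definition beta_rel :: "'a set \<Rightarrow> 'b set \<Rightarrow> ('a \<times> 'b) set \<Rightarrow> ('a set set \<times> 'b set set) set" where
  "beta_rel A B R = {(F, G). F \<in> beta A \<and> G \<in> beta B \<and> (\<forall>S\<in>F. R `` S \<in> G)}"

definition delta :: "'a set \<Rightarrow> 'a set set set \<Rightarrow> 'a set set set" where
  "delta A FF = beta_rel (Pow A) A {(S, x). S \<subseteq> A \<and> x \<in> S} `` {FF}"

lemma delta_eq:
  assumes FF: "FF \<in> beta (Pow A)"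
  shows "delta A FF = {F \<in> beta A. \<forall>\<A>\<in>FF. \<Union>\<A> \<in> F}"
proof -
  have sub: "FF \<subseteq> Pow (Pow A)"
    using FF by (simp add: beta_def ultrafilter_on_def)
  have img: "{(S, x). S \<subseteq> A \<and> x \<in> S} `` \<A> = \<Union>\<A>" if "\<A> \<in> FF" for \<A>
    using subsetD[OF sub that] by (auto simp: Image_def)
  have "delta A FF =
      {F \<in> beta A. \<forall>\<A>\<in>FF. {(S, x). S \<subseteq> A \<and> x \<in> S} `` \<A> \<in> F}"
    using FF by (simp add: delta_def beta_rel_def Image_singleton)
  also have "\<dots> = {F \<in> beta A. \<forall>\<A>\<in>FF. \<Union>\<A> \<in> F}"
    by (intro Collect_cong conj_cong ball_cong refl) (simp only: img)
  finally show ?thesis .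
qed

type_synonym 'a structured = "'a set \<times> ('a set set \<Rightarrow> 'a)"

definition beta_semialgebra :: "'a structured \<Rightarrow> bool" where
  "beta_semialgebra = (\<lambda>(A, a).
     a \<in> beta A \<rightarrow> A \<and>
     (\<forall>FF \<in> beta (beta A). a (beta_map (beta A) A a FF) = a (beta_mult A FF)))"

definition semialgebra_map :: "'a structured \<Rightarrow> 'b structured \<Rightarrow> ('a \<Rightarrow> 'b) \<Rightarrow> bool" where
  "semialgebra_map = (\<lambda>(A, a) (B, b) f.
     f \<in> A \<rightarrow> B \<and> (\<forall>F \<in> beta A. b (beta_map A B f F) = f (a F)))"

definition idempotent_endo :: "'a structured \<Rightarrow> ('a \<Rightarrow> 'a) \<Rightarrow> bool" where
  "idempotent_endo SA e \<longleftrightarrow> semialgebra_map SA SA e \<and> (\<forall>x \<in> fst SA. e (e x) = e x)"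

definition is_splitting ::
  "'a structured \<Rightarrow> ('a \<Rightarrow> 'a) \<Rightarrow> 'b structured \<Rightarrow> ('b \<Rightarrow> 'a) \<Rightarrow> ('a \<Rightarrow> 'b) \<Rightarrow> bool" where
  "is_splitting SA e SK i p \<longleftrightarrow>
     beta_semialgebra SA \<and> beta_semialgebra SK \<and> idempotent_endo SA e \<and>
     semialgebra_map SK SA i \<and> semialgebra_map SA SK p \<and>
     (\<forall>k \<in> fst SK. p (i k) = k) \<and> (\<forall>x \<in> fst SA. i (p x) = e x)"

definition pow_semialgebra :: "'a structured \<Rightarrow> 'a set structured" where
  "pow_semialgebra = (\<lambda>(A, a). (Pow A, \<lambda>FF. a ` delta A FF))"

definition pow_idem :: "'a structured \<Rightarrow> 'a set \<Rightarrow> 'a set" where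
  "pow_idem = (\<lambda>(A, a) B. a ` delta A (beta_unit (Pow A) B))"

text \<open>
  The idempotent is split through its set of fixed points: \<open>lift_incl\<close> is the inclusion and
  \<open>lift_proj\<close> the corestriction of the idempotent. If both are to be maps of semialgebras,
  the structure \<open>k\<close> on the fixed points is forced:
  \<open>k = k \<circ> \<beta>\<pi> \<circ> \<beta>\<iota> = \<pi> \<circ> s \<circ> \<beta>\<iota>\<close>, where \<open>s\<close> is the structure of \<open>pow_semialgebra\<close>.
  Structure maps are restricted to their domain, so that equality of algebras is equality of pairs.
\<close>

definition lift_incl :: "'a structured \<Rightarrow> 'a set \<Rightarrow> 'a set" where
  "lift_incl SA = (\<lambda>B. B)"

definition lift_proj :: "'a structured \<Rightarrow> 'a set \<Rightarrow> 'a set" where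
  "lift_proj SA = pow_idem SA"

definition lift_carrier :: "'a structured \<Rightarrow> 'a set set" where
  "lift_carrier SA = {B \<in> Pow (fst SA). pow_idem SA B = B}"

definition lift_obj :: "'a structured \<Rightarrow> 'a set structured" where
  "lift_obj SA =
     (lift_carrier SA,
      restrict
        (\<lambda>F. lift_proj SA
               (snd (pow_semialgebra SA)
                 (beta_map (lift_carrier SA) (Pow (fst SA)) (lift_incl SA) F)))
        (beta (lift_carrier SA)))"

text \<open>
  The next three predicates say that \<open>g\<close> is the action of the weak lifting on a map \<open>f\<close> of
  algebras (naturality of \<open>\<iota>\<close> and \<open>\<pi>\<close>), and that \<open>u\<close> and \<open>m\<close> are the components of the
  lifted unit and multiplication at an algebra.
\<close>

definition is_lift_map ::
  "'a structured \<Rightarrow> 'b structured \<Rightarrow> ('a \<Rightarrow> 'b) \<Rightarrow> ('a set \<Rightarrow> 'b set) \<Rightarrow> bool" where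
  "is_lift_map SA SB f g \<longleftrightarrow>
     semialgebra_map (lift_obj SA) (lift_obj SB) g \<and>
     (\<forall>B \<in> fst (lift_obj SA). lift_incl SB (g B) = f ` lift_incl SA B) \<and>
     (\<forall>B \<in> Pow (fst SA). lift_proj SB (f ` B) = g (lift_proj SA B))"

definition is_lift_unit :: "'a structured \<Rightarrow> ('a \<Rightarrow> 'a set) \<Rightarrow> bool" where
  "is_lift_unit SA u \<longleftrightarrow>
     semialgebra_map SA (lift_obj SA) u \<and>
     (\<forall>x \<in> fst SA. lift_incl SA (u x) = {x}) \<and>
     (\<forall>x \<in> fst SA. lift_proj SA {x} = u x)"

definition is_lift_mult :: "'a structured \<Rightarrow> ('a set set \<Rightarrow> 'a set) \<Rightarrow> bool" where
  "is_lift_mult SA m \<longleftrightarrow>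
     semialgebra_map (lift_obj (lift_obj SA)) (lift_obj SA) m \<and>
     (\<forall>\<A> \<in> fst (lift_obj (lift_obj SA)).
        lift_incl SA (m \<A>) = \<Union> (lift_incl SA ` lift_incl (lift_obj SA) \<A>)) \<and>
     (\<forall>\<A> \<in> Pow (Pow (fst SA)).
        m (lift_proj (lift_obj SA) (lift_proj SA ` \<A>)) = lift_proj SA (\<Union> \<A>))"

definition ultrafilter_converges :: "'a topology \<Rightarrow> 'a set set \<Rightarrow> 'a \<Rightarrow> bool" where
  "ultrafilter_converges X F x \<longleftrightarrow>
     x \<in> topspace X \<and> (\<forall>U. openin X U \<and> x \<in> U \<longrightarrow> U \<in> F)"

definition manes_algebra :: "'a topology \<Rightarrow> 'a structured" where
  "manes_algebra X =
     (topspace X, restrict (\<lambda>F. THE x. ultrafilter_converges X F x) (beta (topspace X)))"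

definition vietoris :: "'a topology \<Rightarrow> 'a set topology" where
  "vietoris X = topology_generated_by
     ((\<lambda>C. {A. closedin X A \<and> A \<inter> C = {}}) ` {C. closedin X C} \<union>
      (\<lambda>C. {A. closedin X A \<and> \<not> A \<subseteq> C}) ` {C. closedin X C})"

lemma topspace_vietoris: "topspace (vietoris X) = {A. closedin X A}"
proof
  show "topspace (vietoris X) \<subseteq> {A. closedin X A}"
    unfolding vietoris_def topology_generated_by_topspace by auto
  show "{A. closedin X A} \<subseteq> topspace (vietoris X)"
    unfolding vietoris_def topology_generated_by_topspace
    by (rule Union_upper, rule UnI1, rule image_eqI[where x = "{}"]) simp_all
qed

definition vietoris_map :: "('a \<Rightarrow> 'b) \<Rightarrow> 'a set \<Rightarrow> 'b set" where
  "vietoris_map f = (\<lambda>A. f ` A)"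

definition vietoris_unit :: "'a \<Rightarrow> 'a set" where
  "vietoris_unit = (\<lambda>x. {x})"

definition vietoris_mult :: "'a set set \<Rightarrow> 'a set" where
  "vietoris_mult = (\<lambda>\<A>. \<Union> \<A>)"

end

theory Submission
  imports Defs
begin

text \<open>
  For a compact Hausdorff space \<open>X\<close>, extending filters to ultrafilters shows that the structure
  map of \<open>pow_semialgebra (manes_algebra X)\<close> sends \<open>FF\<close> to the intersection of the closures of
  the unions \<open>\<Union>\<A>\<close> for \<open>\<A> \<in> FF\<close>. Hence the idempotent is the closure operator, with fixed points
  the closed sets, and that intersection is also the limit in the Vietoris topology of the image of
  \<open>FF\<close> under closure. So Vietoris ultrafilters converge, the Vietoris space is compact Hausdorff,
  and all the equations between structure maps reduce to Manes' theorem for \<open>X\<close> and the Vietoris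
  space, together with continuity of direct images, singletons and unions.
\<close>

section \<open>Ultrafilters\<close>

lemma betaD:
  assumes "F \<in> beta A"
  shows "F \<subseteq> Pow A" "A \<in> F" "{} \<notin> F"
    and "\<And>S T. S \<in> F \<Longrightarrow> T \<in> F \<Longrightarrow> S \<inter> T \<in> F"
    and "\<And>S T. S \<in> F \<Longrightarrow> S \<subseteq> T \<Longrightarrow> T \<subseteq> A \<Longrightarrow> T \<in> F"
    and "\<And>S. S \<subseteq> A \<Longrightarrow> S \<notin> F \<Longrightarrow> A - S \<in> F"
  proof -
  have u: "ultrafilter_on A F" using assms by (simp add: beta_def)
  show "F \<subseteq> Pow A" "A \<in> F" "{} \<notin> F" using u by (simp_all add: ultrafilter_on_def)
  have i: "\<forall>S\<in>F. \<forall>T\<in>F. S \<inter> T \<in> F" and s: "\<forall>S\<in>F. \<forall>T. S \<subseteq> T \<and> T \<subseteq> A \<longrightarrow> T \<in> F"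
    and c: "\<forall>S. S \<subseteq> A \<longrightarrow> S \<in> F \<or> A - S \<in> F"
    using u unfolding ultrafilter_on_def by simp_all
  show "S \<inter> T \<in> F" if "S \<in> F" "T \<in> F" for S T using i that by metis
  show "T \<in> F" if "S \<in> F" "S \<subseteq> T" "T \<subseteq> A" for S T using s that by metis
  show "A - S \<in> F" if "S \<subseteq> A" "S \<notin> F" for S using c that by metis
qed

lemma betaI:
  assumes "F \<subseteq> Pow A" "A \<in> F" "{} \<notin> F"
    and "\<And>S T. S \<in> F \<Longrightarrow> T \<in> F \<Longrightarrow> S \<inter> T \<in> F"
    and "\<And>S T. S \<in> F \<Longrightarrow> S \<subseteq> T \<Longrightarrow> T \<subseteq> A \<Longrightarrow> T \<in> F"
    and "\<And>S. S \<subseteq> A \<Longrightarrow> S \<notin> F \<Longrightarrow> A - S \<in> F"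
  shows "F \<in> beta A"
  unfolding beta_def ultrafilter_on_def mem_Collect_eq
  by (intro conjI ballI allI impI; (elim conjE)?) (use assms in metis)+

lemma beta_memberE:
  assumes "F \<in> beta A" "S \<in> F"
  obtains x where "x \<in> S"
  using betaD(3)[OF assms(1)] assms(2) by (cases "S = {}") auto

lemma beta_disjoint:
  assumes "F \<in> beta A" "S \<in> F" "T \<in> F"
  shows "S \<inter> T \<noteq> {}"
  using betaD(3,4)[OF assms(1)] assms(2,3) by metis

lemma beta_Inter:
  assumes F: "F \<in> beta A" and "finite H" "H \<subseteq> F"
  shows "A \<inter> \<Inter>H \<in> F"
  using assms(2,3)
proof (induction H)
  case empty
  then show ?case using betaD(2)[OF F] by simp
next
  case (insert S H)
  have "A \<inter> \<Inter>(insert S H) = S \<inter> (A \<inter> \<Inter>H)" by blast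
  then show ?case using insert betaD(4)[OF F, of S "A \<inter> \<Inter>H"] by simp
qed

lemma beta_map_in_beta:
  assumes f: "f \<in> A \<rightarrow> B" and F: "F \<in> beta A"
  shows "beta_map A B f F \<in> beta B"
proof (rule betaI)
  note u = betaD[OF F]
  have "{x \<in> A. f x \<in> B} = A" using f by auto
  then show "B \<in> beta_map A B f F" using u(2) by (simp add: beta_map_def)
  show "S \<inter> T \<in> beta_map A B f F" if "S \<in> beta_map A B f F" "T \<in> beta_map A B f F" for S T
  proof -
    have "{x \<in> A. f x \<in> S \<inter> T} = {x \<in> A. f x \<in> S} \<inter> {x \<in> A. f x \<in> T}" by auto
    then show ?thesis using that u(4) by (auto simp: beta_map_def)
  qed
  show "T \<in> beta_map A B f F" if "S \<in> beta_map A B f F" "S \<subseteq> T" "T \<subseteq> B" for S T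
    using that u(5)[of "{x \<in> A. f x \<in> S}" "{x \<in> A. f x \<in> T}"] by (auto simp: beta_map_def)
  show "B - S \<in> beta_map A B f F" if "S \<subseteq> B" "S \<notin> beta_map A B f F" for S
  proof -
    have "A - {x \<in> A. f x \<in> S} = {x \<in> A. f x \<in> B - S}" using f by auto
    then show ?thesis using that u(6)[of "{x \<in> A. f x \<in> S}"] by (auto simp: beta_map_def)
  qed
qed (use betaD(3)[OF F] in \<open>auto simp: beta_map_def\<close>)

lemma beta_map_cong:
  assumes "\<And>x. x \<in> A \<Longrightarrow> f x = g x"
  shows "beta_map A B f F = beta_map A B g F"
proof -
  have "{x \<in> A. f x \<in> S} = {x \<in> A. g x \<in> S}" for S using assms by auto
  then show ?thesis by (simp add: beta_map_def)
qed

lemma beta_map_comp: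
  assumes "f \<in> A \<rightarrow> B"
  shows "beta_map B C g (beta_map A B f F) = beta_map A C (\<lambda>x. g (f x)) F"
proof -
  have "{x \<in> A. f x \<in> {x \<in> B. g x \<in> S}} = {x \<in> A. g (f x) \<in> S}" for S using assms by auto
  moreover have "{x \<in> B. g x \<in> S} \<subseteq> B" for S by auto
  ultimately show ?thesis unfolding beta_map_def by auto
qed

lemma beta_map_ident:
  assumes "F \<in> beta A"
  shows "beta_map A A (\<lambda>x. x) F = F"
proof -
  have "S \<subseteq> A \<Longrightarrow> {x \<in> A. x \<in> S} = S" for S by auto
  then show ?thesis using betaD(1)[OF assms] unfolding beta_map_def by auto
qed

lemma beta_unit_in_beta: "x \<in> A \<Longrightarrow> beta_unit A x \<in> beta A"
  by (rule betaI) (auto simp: beta_unit_def)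

lemma beta_mult_in_beta:
  assumes FF: "FF \<in> beta (beta A)"
  shows "beta_mult A FF \<in> beta A"
proof (rule betaI)
  note u = betaD[OF FF]
  have "{F \<in> beta A. A \<in> F} = beta A" using betaD(2) by auto
  then show "A \<in> beta_mult A FF" using u(2) by (simp add: beta_mult_def)
  have "{F \<in> beta A. {} \<in> F} = {}" using betaD(3) by auto
  then show "{} \<notin> beta_mult A FF" using u(3) unfolding beta_mult_def mem_Collect_eq by metis
  show "S \<inter> T \<in> beta_mult A FF" if "S \<in> beta_mult A FF" "T \<in> beta_mult A FF" for S T
  proof -
    have sub: "{F \<in> beta A. S \<in> F} \<inter> {F \<in> beta A. T \<in> F} \<subseteq> {F \<in> beta A. S \<inter> T \<in> F}"
      by (clarsimp simp: betaD(4))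
    have "{F \<in> beta A. S \<in> F} \<inter> {F \<in> beta A. T \<in> F} \<in> FF"
      using that by (intro u(4)) (simp_all add: beta_mult_def)
    then have "{F \<in> beta A. S \<inter> T \<in> F} \<in> FF" using sub by (rule u(5)) simp
    then show ?thesis using that by (auto simp: beta_mult_def)
  qed
  show "T \<in> beta_mult A FF" if "S \<in> beta_mult A FF" "S \<subseteq> T" "T \<subseteq> A" for S T
  proof -
    have sub: "{F \<in> beta A. S \<in> F} \<subseteq> {F \<in> beta A. T \<in> F}"
      using that by (clarsimp simp: betaD(5)[of _ A S T])
    have "{F \<in> beta A. S \<in> F} \<in> FF" using that by (simp add: beta_mult_def)
    then have "{F \<in> beta A. T \<in> F} \<in> FF" using sub by (rule u(5)) simp
    then show ?thesis using that by (simp add: beta_mult_def)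
  qed
  show "A - S \<in> beta_mult A FF" if "S \<subseteq> A" "S \<notin> beta_mult A FF" for S
  proof -
    have sub: "beta A - {F \<in> beta A. S \<in> F} \<subseteq> {F \<in> beta A. A - S \<in> F}"
      using that by (clarsimp simp: betaD(6))
    have "beta A - {F \<in> beta A. S \<in> F} \<in> FF"
      using that by (intro u(6)) (auto simp: beta_mult_def)
    then have "{F \<in> beta A. A - S \<in> F} \<in> FF" using sub by (rule u(5)) simp
    then show ?thesis by (simp add: beta_mult_def)
  qed
qed (auto simp: beta_mult_def)

text \<open>A set \<open>S\<close> belongs to either side exactly when the ultrafilters containing
  its \<open>f\<close>-preimage form a member of \<open>FF\<close>. That \<open>f\<close> maps
  \<open>A\<close> into \<open>B\<close> keeps the pushforwards inside
  \<open>beta B\<close>.\<close>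

lemma beta_mult_natural:
  assumes "f \<in> A \<rightarrow> B"
  shows "beta_mult B (beta_map (beta A) (beta B) (beta_map A B f) FF)
    = beta_map A B f (beta_mult A FF)"
proof -
  have "{F \<in> beta A. beta_map A B f F \<in> {G \<in> beta B. S \<in> G}}
      = {F \<in> beta A. {x \<in> A. f x \<in> S} \<in> F}" if "S \<subseteq> B" for S
    using that beta_map_in_beta[OF assms] by (auto simp: beta_map_def)
  then show ?thesis
    unfolding beta_mult_def beta_map_def[of "beta A"] by (auto simp: beta_map_def)
qed

section \<open>Extending families of sets to ultrafilters\<close>

text \<open>Zorn's lemma yields a maximal family with the finite intersection property above
  \<open>G\<close>, and maximality forces the ultrafilter axioms. The factor \<open>A\<close> keeps
  the condition meaningful for empty \<open>H\<close>, where \<open>\<Inter>H\<close> is the whole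
  type.\<close>

lemma ultrafilter_extends_fip:
  assumes GA: "G \<subseteq> Pow A" and fip: "\<And>H. finite H \<Longrightarrow> H \<subseteq> G \<Longrightarrow> A \<inter> \<Inter>H \<noteq> {}"
  obtains F where "F \<in> beta A" "G \<subseteq> F"
proof -
  define P where "P = {M. G \<subseteq> M \<and> M \<subseteq> Pow A \<and> (\<forall>H. finite H \<and> H \<subseteq> M \<longrightarrow> A \<inter> \<Inter>H \<noteq> {})}"
  have "\<exists>M\<in>P. \<forall>N\<in>P. M \<subseteq> N \<longrightarrow> N = M"
  proof (rule subset_Zorn_nonempty)
    have "G \<in> P" using GA fip by (simp add: P_def)
    then show "P \<noteq> {}" by blast
    fix C assume C: "C \<noteq> {}" "subset.chain P C"
    then have CP: "C \<subseteq> P" by (simp add: subset_chain_def)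
    have "A \<inter> \<Inter>H \<noteq> {}" if H: "finite H" "H \<subseteq> \<Union>C" for H
    proof -
      obtain M where "M \<in> C" "H \<subseteq> M"
        using finite_subset_Union_chain[OF H C] by blast
      then show ?thesis using CP H(1) by (auto simp: P_def)
    qed
    moreover have bounds: "G \<subseteq> M" "M \<subseteq> Pow A" if "M \<in> C" for M
      using CP that by (auto simp: P_def)
    have "G \<subseteq> \<Union>C" using C(1) bounds(1) by (metis Union_upper all_not_in_conv order_trans)
    moreover have "\<Union>C \<subseteq> Pow A" by (rule Union_least) (rule bounds(2))
    ultimately show "\<Union>C \<in> P" by (simp add: P_def)
  qed
  then obtain M where M: "M \<in> P" and max: "\<And>N. N \<in> P \<Longrightarrow> M \<subseteq> N \<Longrightarrow> N = M" by blast
  have Mfip: "A \<inter> \<Inter>H \<noteq> {}" if "finite H" "H \<subseteq> M" for H using M that by (auto simp: P_def)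
  have MA: "M \<subseteq> Pow A" "G \<subseteq> M" using M by (auto simp: P_def)
  \<comment> \<open>Maximality enters only here: a set meeting every finite intersection from
    \<open>M\<close> can be adjoined to \<open>M\<close>, so it is already there. The ultrafilter
    axioms below are instances of this criterion.\<close>
  have in_M: "S \<in> M" if S: "S \<subseteq> A" "\<And>H. finite H \<Longrightarrow> H \<subseteq> M \<Longrightarrow> S \<inter> \<Inter>H \<noteq> {}" for S
  proof -
    have "A \<inter> \<Inter>H \<noteq> {}" if "finite H" "H \<subseteq> insert S M" for H
    proof -
      have "S \<inter> \<Inter>(H - {S}) \<noteq> {}" using that by (intro S(2)) auto
      moreover have "S \<inter> \<Inter>(H - {S}) \<subseteq> A \<inter> \<Inter>H" using S(1) by blast
      ultimately show ?thesis by blast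
    qed
    then have "insert S M \<in> P" using MA S(1) by (auto simp: P_def)
    then show ?thesis using max by blast
  qed
  have "M \<in> beta A"
  proof (rule betaI)
    show "{} \<notin> M" using Mfip[of "{{}}"] by auto
    show "A \<in> M" by (rule in_M) (use Mfip in auto)
    show "S \<inter> T \<in> M" if "S \<in> M" "T \<in> M" for S T
    proof (rule in_M)
      show "S \<inter> T \<inter> \<Inter>H \<noteq> {}" if "finite H" "H \<subseteq> M" for H
        using Mfip[of "insert S (insert T H)"] that \<open>S \<in> M\<close> \<open>T \<in> M\<close> by auto
    qed (use that MA in auto)
    show "T \<in> M" if "S \<in> M" "S \<subseteq> T" "T \<subseteq> A" for S T
    proof (rule in_M)
      show "T \<inter> \<Inter>H \<noteq> {}" if "finite H" "H \<subseteq> M" for H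
        using Mfip[of "insert S H"] that \<open>S \<in> M\<close> \<open>S \<subseteq> T\<close> by auto
    qed (use that in auto)
    show "A - S \<in> M" if "S \<subseteq> A" "S \<notin> M" for S
    proof (rule in_M)
      \<comment> \<open>Since \<open>S\<close> fails the criterion, some finite intersection from
        \<open>M\<close> misses it; refining any \<open>H\<close> by this \<open>K\<close> leaves
        only points outside \<open>S\<close>.\<close>
      obtain K where K: "finite K" "K \<subseteq> M" "S \<inter> \<Inter>K = {}" 
        using in_M[OF \<open>S \<subseteq> A\<close>] \<open>S \<notin> M\<close> by metis
      show "(A - S) \<inter> \<Inter>H \<noteq> {}" if "finite H" "H \<subseteq> M" for H
      proof -
        have "A \<inter> (\<Inter>H \<inter> \<Inter>K) \<noteq> {}"
          using Mfip[of "H \<union> K"] that K(1,2) by (simp add: Inter_Un_distrib)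
        then show ?thesis using K(3) by blast
      qed
    qed auto
  qed (use MA in auto)
  then show ?thesis using MA that by blast
qed

text \<open>By induction, every finite intersection of members of a downward directed family
  contains a member, so it is nonempty.\<close>

lemma ultrafilter_extends_directed:
  assumes "G \<subseteq> Pow A" "G \<noteq> {}" "{} \<notin> G"
    and dir: "\<And>S T. S \<in> G \<Longrightarrow> T \<in> G \<Longrightarrow> \<exists>R\<in>G. R \<subseteq> S \<inter> T"
  obtains F where "F \<in> beta A" "G \<subseteq> F"
proof (rule ultrafilter_extends_fip)
  show "A \<inter> \<Inter>H \<noteq> {}" if "finite H" "H \<subseteq> G" for H
  proof -
    have "\<exists>R\<in>G. R \<subseteq> A \<inter> \<Inter>H" using that
    proof (induction H)
      case empty
      obtain S where "S \<in> G" using assms(2) by blast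
      moreover have "S \<subseteq> A \<inter> \<Inter>{}" using \<open>S \<in> G\<close> assms(1) by blast
      ultimately show ?case by metis
    next
      case (insert S H)
      then obtain R where R: "R \<in> G" "R \<subseteq> A \<inter> \<Inter>H" by (metis insert_subset)
      have "S \<in> G" using insert.prems by simp
      then obtain Q where Q: "Q \<in> G" "Q \<subseteq> R \<inter> S" using dir R(1) by metis
      then have "Q \<subseteq> A \<inter> \<Inter>(insert S H)" using R(2) by auto
      then show ?case using Q(1) by metis
    qed
    then show ?thesis using assms(3) by (metis subset_empty)
  qed
qed (use assms(1) that in auto)

section \<open>Convergence in compact Hausdorff spaces\<close>

lemma compact_space_Inter_nonempty:
  assumes "compact_space X" "\<And>C. C \<in> \<U> \<Longrightarrow> closedin X C"
    and "\<And>H. finite H \<Longrightarrow> H \<subseteq> \<U> \<Longrightarrow> \<Inter>H \<noteq> {}"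
  shows "\<Inter>\<U> \<noteq> {}"
  using assms(1)[unfolded compact_space_fip, rule_format, of \<U>] assms(2,3) by simp

text \<open>The closed members of \<open>F\<close> have the finite intersection property, so they
  share a point. An open neighbourhood of it outside \<open>F\<close> would have its closed
  complement in \<open>F\<close>, yet that complement misses the point.\<close>

lemma compact_space_ultrafilter_converges:
  assumes "compact_space X" "F \<in> beta (topspace X)"
  obtains x where "ultrafilter_converges X F x"
proof -
  note u = betaD[OF assms(2)]
  let ?U = "{C. closedin X C \<and> C \<in> F}"
  have "\<Inter>H \<noteq> {}" if "finite H" "H \<subseteq> ?U" for H
  proof -
    have "H \<subseteq> F" using that(2) by auto
    then have "topspace X \<inter> \<Inter>H \<in> F" by (rule beta_Inter[OF assms(2) that(1)])
    then show ?thesis using u(3) by auto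
  qed
  then have "\<Inter>?U \<noteq> {}" by (rule compact_space_Inter_nonempty[OF assms(1), rotated]) simp_all
  then obtain x where x: "\<And>C. closedin X C \<Longrightarrow> C \<in> F \<Longrightarrow> x \<in> C" by blast
  have "U \<in> F" if "openin X U" "x \<in> U" for U
  proof (rule ccontr)
    assume "U \<notin> F"
    then have "topspace X - U \<in> F" using u(6) openin_subset[OF that(1)] by blast
    then show False using x[of "topspace X - U"] that by auto
  qed
  then show ?thesis using that x[OF closedin_topspace u(2)] by (auto simp: ultrafilter_converges_def)
qed

text \<open>A family of closed sets with the finite intersection property extends to an ultrafilter,
  and a limit of that ultrafilter lies in every closed member.\<close>

lemma compact_space_if_ultrafilters_converge:
  assumes "\<And>F. F \<in> beta (topspace X) \<Longrightarrow> \<exists>x. ultrafilter_converges X F x"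
  shows "compact_space X"
  unfolding compact_space_fip
proof (intro allI impI, elim conjE)
  fix \<U> assume cl: "\<forall>C\<in>\<U>. closedin X C" and fip: "\<forall>H. finite H \<and> H \<subseteq> \<U> \<longrightarrow> \<Inter>H \<noteq> {}"
  show "\<Inter>\<U> \<noteq> {}"
  proof (cases "\<U> = {}")
    case False
    then obtain D where D: "D \<in> \<U>" by blast
    have "topspace X \<inter> \<Inter>H \<noteq> {}" if "finite H" "H \<subseteq> \<U>" for H
    proof -
      \<comment> \<open>Inserting \<open>D\<close> produces a common point inside the space even
        when \<open>H\<close> is empty.\<close>
      have "\<Inter>(insert D H) \<noteq> {}" using fip that D by (metis finite_insert insert_subset)
      moreover have "D \<subseteq> topspace X" using closedin_subset cl D by metis
      ultimately show ?thesis by auto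
    qed
    moreover have "\<U> \<subseteq> Pow (topspace X)" using cl closedin_subset by blast
    ultimately obtain F where F: "F \<in> beta (topspace X)" "\<U> \<subseteq> F"
      using ultrafilter_extends_fip by metis
    then obtain x where x: "ultrafilter_converges X F x" using assms by blast
    have "x \<in> C" if "C \<in> \<U>" for C
    proof (rule ccontr)
      assume "x \<notin> C"
      have "openin X (topspace X - C)" using cl that by blast
      then have "topspace X - C \<in> F"
        using x \<open>x \<notin> C\<close> by (simp add: ultrafilter_converges_def)
      then show False using beta_disjoint[OF F(1), of "topspace X - C" C] F(2) that by blast
    qed
    then show ?thesis by blast
  qed auto
qed

lemma Hausdorff_space_ultrafilter_unique:
  assumes "Hausdorff_space X" and F: "F \<in> beta (topspace X)"
    and "ultrafilter_converges X F x" "ultrafilter_converges X F y"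
  shows "x = y"
proof (rule ccontr)
  assume "x \<noteq> y"
  then obtain U V where "openin X U" "openin X V" "x \<in> U" "y \<in> V" "disjnt U V"
    using assms unfolding Hausdorff_space_def ultrafilter_converges_def by metis
  then show False using assms(3,4) beta_disjoint[OF F, of U V]
    by (auto simp: ultrafilter_converges_def disjnt_def)
qed

section \<open>The algebra of a compact Hausdorff space\<close>

lemma fst_manes_algebra [simp]: "fst (manes_algebra X) = topspace X"
  by (simp add: manes_algebra_def)

lemma manes_algebra_eqI:
  assumes "Hausdorff_space X" "F \<in> beta (topspace X)" "ultrafilter_converges X F x"
  shows "snd (manes_algebra X) F = x"
  using assms Hausdorff_space_ultrafilter_unique[OF assms(1,2)]
  by (auto simp: manes_algebra_def intro!: the_equality)

lemma manes_algebra_converges: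
  assumes "compact_space X" "Hausdorff_space X" "F \<in> beta (topspace X)"
  shows "ultrafilter_converges X F (snd (manes_algebra X) F)"
  using compact_space_ultrafilter_converges[OF assms(1,3)] manes_algebra_eqI[OF assms(2,3)] by metis

lemma manes_algebra_in_topspace:
  assumes "compact_space X" "Hausdorff_space X" "F \<in> beta (topspace X)"
  shows "snd (manes_algebra X) F \<in> topspace X"
  using manes_algebra_converges[OF assms] by (simp add: ultrafilter_converges_def)

text \<open>Preimages of open neighbourhoods are open neighbourhoods, so the pushforward of an
  ultrafilter converges to the image of its limit; limits in \<open>Y\<close> are unique.\<close>

lemma semialgebra_map_manes:
  assumes X: "compact_space X" "Hausdorff_space X" and Y: "Hausdorff_space Y"
    and f: "continuous_map X Y f"
  shows "semialgebra_map (manes_algebra X) (manes_algebra Y) f"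
proof -
  have fn: "f \<in> topspace X \<rightarrow> topspace Y" using f continuous_map_funspace by blast
  have "snd (manes_algebra Y) (beta_map (topspace X) (topspace Y) f F) = f (snd (manes_algebra X) F)"
    if F: "F \<in> beta (topspace X)" for F
  proof (rule manes_algebra_eqI[OF Y beta_map_in_beta[OF fn F]])
    have lim: "ultrafilter_converges X F (snd (manes_algebra X) F)"
      by (rule manes_algebra_converges[OF X F])
    have "U \<in> beta_map (topspace X) (topspace Y) f F"
      if "openin Y U" "f (snd (manes_algebra X) F) \<in> U" for U
      using lim that openin_continuous_map_preimage[OF f that(1)] openin_subset
      by (auto simp: ultrafilter_converges_def beta_map_def)
    then show "ultrafilter_converges Y (beta_map (topspace X) (topspace Y) f F)
        (f (snd (manes_algebra X) F))"
      using lim fn by (auto simp: ultrafilter_converges_def)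
  qed
  then show ?thesis
    using fn by (simp add: semialgebra_map_def case_prod_beta)
qed

text \<open>If \<open>U\<close> is an open neighbourhood of the limit of the pushed-forward
  \<open>FF\<close>, then the ultrafilters with limit in \<open>U\<close> form a member of
  \<open>FF\<close>. All of them contain \<open>U\<close>, so \<open>U\<close> lies in
  \<open>beta_mult\<close>, which therefore has the same limit.\<close>

lemma beta_semialgebra_manes:
  assumes X: "compact_space X" "Hausdorff_space X"
  shows "beta_semialgebra (manes_algebra X)"
proof -
  let ?A = "topspace X" and ?a = "snd (manes_algebra X)"
  have fn: "?a \<in> beta ?A \<rightarrow> ?A" using manes_algebra_in_topspace[OF X] by auto
  have "?a (beta_map (beta ?A) ?A ?a FF) = ?a (beta_mult ?A FF)"
    if FF: "FF \<in> beta (beta ?A)" for FF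
  proof (rule sym, rule manes_algebra_eqI[OF X(2) beta_mult_in_beta[OF FF]])
    have lim: "ultrafilter_converges X (beta_map (beta ?A) ?A ?a FF) (?a (beta_map (beta ?A) ?A ?a FF))"
      by (rule manes_algebra_converges[OF X beta_map_in_beta[OF fn FF]])
    have "U \<in> beta_mult ?A FF"
      if U: "openin X U" "?a (beta_map (beta ?A) ?A ?a FF) \<in> U" for U
    proof -
      have "U \<in> beta_map (beta ?A) ?A ?a FF"
        using lim U by (simp add: ultrafilter_converges_def)
      then have "{F \<in> beta ?A. ?a F \<in> U} \<in> FF" by (simp add: beta_map_def)
      moreover have "{F \<in> beta ?A. ?a F \<in> U} \<subseteq> {F \<in> beta ?A. U \<in> F}"
        using manes_algebra_converges[OF X] U(1) by (auto simp: ultrafilter_converges_def)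
      ultimately have "{F \<in> beta ?A. U \<in> F} \<in> FF"
        by (rule betaD(5)[OF FF]) simp
      then show ?thesis using openin_subset[OF U(1)] by (simp add: beta_mult_def)
    qed
    then show "ultrafilter_converges X (beta_mult ?A FF) (?a (beta_map (beta ?A) ?A ?a FF))"
      using lim by (simp add: ultrafilter_converges_def)
  qed
  then show ?thesis using fn by (simp add: beta_semialgebra_def case_prod_beta)
qed

section \<open>The Vietoris space\<close>

text \<open>The factor \<open>topspace X\<close> matters for empty \<open>FF\<close>: it makes the
  value a closed set for every argument.\<close>

definition pow_limit :: "'a topology \<Rightarrow> 'a set set set \<Rightarrow> 'a set" where
  "pow_limit X FF = topspace X \<inter> (\<Inter>\<A>\<in>FF. X closure_of \<Union>\<A>)"

lemma closedin_pow_limit: "closedin X (pow_limit X FF)"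
proof -
  have "pow_limit X FF = \<Inter> (insert (topspace X) ((\<lambda>\<A>. X closure_of \<Union>\<A>) ` FF))"
    by (auto simp: pow_limit_def)
  then show ?thesis by (simp only:) (rule closedin_Inter; auto)
qed

text \<open>A limit of an ultrafilter containing every \<open>\<Union>\<A>\<close> is adherent to
  each of these unions. Conversely, for a point adherent to all of them, the traces of its open
  neighbourhoods on the unions form a filter base, and any ultrafilter above it converges to the
  point.\<close>

lemma image_delta_manes:
  assumes X: "compact_space X" "Hausdorff_space X" and FF: "FF \<in> beta (Pow (topspace X))"
  shows "snd (manes_algebra X) ` delta (topspace X) FF = pow_limit X FF"
proof (intro equalityI subsetI)
  fix x assume "x \<in> snd (manes_algebra X) ` delta (topspace X) FF"
  then obtain F where F: "F \<in> beta (topspace X)" "\<forall>\<A>\<in>FF. \<Union>\<A> \<in> F" "ultrafilter_converges X F x"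
    using manes_algebra_converges[OF X] by (auto simp: delta_eq[OF FF])
  have "\<Union>\<A> \<inter> U \<noteq> {}" if "\<A> \<in> FF" "openin X U" "x \<in> U" for \<A> U
    using that F beta_disjoint[OF F(1)] by (auto simp: ultrafilter_converges_def)
  then show "x \<in> pow_limit X FF"
    using F(3) by (fastforce simp: pow_limit_def in_closure_of ultrafilter_converges_def)
next
  fix x assume x: "x \<in> pow_limit X FF"
  note u = betaD[OF FF]
  let ?G = "{U \<inter> \<Union>\<A> |U \<A>. openin X U \<and> x \<in> U \<and> \<A> \<in> FF}"
  have xX: "x \<in> topspace X" using x by (simp add: pow_limit_def)
  \<comment> \<open>The choice of the whole space for \<open>U\<close> puts each union into
    \<open>?G\<close>, which will place \<open>F\<close> in \<open>delta\<close>.\<close>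
  have top: "topspace X \<inter> \<Union>\<A> \<in> ?G" if "\<A> \<in> FF" for \<A> using that xX by blast
  have sub: "topspace X \<inter> \<Union>\<A> = \<Union>\<A>" if "\<A> \<in> FF" for \<A> using u(1) that by blast
  obtain F where F: "F \<in> beta (topspace X)" "?G \<subseteq> F"
  proof (rule ultrafilter_extends_directed)
    show "?G \<noteq> {}" using top[OF u(2)] by blast
    show "?G \<subseteq> Pow (topspace X)" using u(1) by blast
    show "{} \<notin> ?G"
    proof
      assume "{} \<in> ?G"
      then obtain U \<A> where U: "U \<inter> \<Union>\<A> = {}" "openin X U" "x \<in> U" "\<A> \<in> FF" by auto
      then have "x \<in> X closure_of \<Union>\<A>" using x by (simp add: pow_limit_def)
      then show False using U unfolding in_closure_of by blast
    qed
    show "\<exists>R\<in>?G. R \<subseteq> S \<inter> T" if ST: "S \<in> ?G" "T \<in> ?G" for S T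
    proof -
      obtain U \<A> V \<B> where S: "S = U \<inter> \<Union>\<A>" "openin X U" "x \<in> U" "\<A> \<in> FF"
        and T: "T = V \<inter> \<Union>\<B>" "openin X V" "x \<in> V" "\<B> \<in> FF"
        using ST by blast
      have "(U \<inter> V) \<inter> \<Union>(\<A> \<inter> \<B>) \<in> ?G" using S T u(4) by blast
      moreover have "(U \<inter> V) \<inter> \<Union>(\<A> \<inter> \<B>) \<subseteq> S \<inter> T" unfolding S(1) T(1) by blast
      ultimately show ?thesis by blast
    qed
  qed (use that in blast)
  have "F \<in> delta (topspace X) FF" using F top sub by (auto simp: delta_eq[OF FF])
  moreover have "snd (manes_algebra X) F = x"
  proof (rule manes_algebra_eqI[OF X(2) F(1)])
    have "U \<in> F" if "openin X U" "x \<in> U" for U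
    proof -
      \<comment> \<open>Dually, the choice of the full power set for \<open>\<A>\<close> puts each
        open neighbourhood of \<open>x\<close> into \<open>F\<close>.\<close>
      have "U \<inter> \<Union>(Pow (topspace X)) = U" using openin_subset[OF that(1)] by blast
      moreover have "U \<inter> \<Union>(Pow (topspace X)) \<in> F"
        by (rule subsetD[OF F(2)]) (use that u(2) in blast)
      ultimately show ?thesis by (simp only:)
    qed
    then show "ultrafilter_converges X F x" using xX by (simp add: ultrafilter_converges_def)
  qed
  ultimately show "x \<in> snd (manes_algebra X) ` delta (topspace X) FF" by blast
qed

lemma snd_pow_semialgebra_manes:
  assumes "compact_space X" "Hausdorff_space X" "FF \<in> beta (Pow (topspace X))"
  shows "snd (pow_semialgebra (manes_algebra X)) FF = pow_limit X FF"
  using image_delta_manes[OF assms] by (simp add: pow_semialgebra_def case_prod_beta)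

lemma fst_pow_semialgebra_manes [simp]:
  "fst (pow_semialgebra (manes_algebra X)) = Pow (topspace X)"
  by (simp add: pow_semialgebra_def case_prod_beta)

text \<open>In the principal ultrafilter at \<open>B\<close>, the member \<open>{B}\<close> bounds
  the intersection above by the closure of \<open>B\<close>; every other member contains
  \<open>B\<close>, so its union has a larger closure.\<close>

lemma pow_idem_manes:
  assumes X: "compact_space X" "Hausdorff_space X" and B: "B \<subseteq> topspace X"
  shows "pow_idem (manes_algebra X) B = X closure_of B"
proof -
  have "pow_idem (manes_algebra X) B = pow_limit X (beta_unit (Pow (topspace X)) B)"
    using image_delta_manes[OF X beta_unit_in_beta] B by (simp add: pow_idem_def case_prod_beta)
  also have "\<dots> = X closure_of B"
  proof
    have "{B} \<in> beta_unit (Pow (topspace X)) B" using B by (simp add: beta_unit_def)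
    then show "pow_limit X (beta_unit (Pow (topspace X)) B) \<subseteq> X closure_of B"
      unfolding pow_limit_def by fastforce
    have "X closure_of B \<subseteq> X closure_of \<Union>\<A>" if "B \<in> \<A>" for \<A>
      using that by (intro closure_of_mono) blast
    then show "X closure_of B \<subseteq> pow_limit X (beta_unit (Pow (topspace X)) B)"
      using closure_of_subset_topspace[of X B] by (auto simp: pow_limit_def beta_unit_def)
  qed
  finally show ?thesis .
qed

lemma lift_carrier_manes:
  assumes "compact_space X" "Hausdorff_space X"
  shows "lift_carrier (manes_algebra X) = topspace (vietoris X)"
proof -
  have "B \<in> Pow (topspace X) \<and> pow_idem (manes_algebra X) B = B \<longleftrightarrow> closedin X B" for B
    by (metis PowD PowI pow_idem_manes[OF assms] closure_of_eq closedin_subset)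
  then show ?thesis by (simp add: lift_carrier_def topspace_vietoris)
qed

lemma lift_proj_manes:
  assumes "compact_space X" "Hausdorff_space X" "B \<subseteq> topspace X"
  shows "lift_proj (manes_algebra X) B = X closure_of B"
  using pow_idem_manes[OF assms] by (simp add: lift_proj_def)

section \<open>Subbasic sets, continuity and convergence in the Vietoris topology\<close>

lemma openin_vietoris_disjoint:
  "closedin X C \<Longrightarrow> openin (vietoris X) {A. closedin X A \<and> A \<inter> C = {}}"
  unfolding vietoris_def by (rule topology_generated_by_Basis) blast

lemma openin_vietoris_not_subset:
  "closedin X C \<Longrightarrow> openin (vietoris X) {A. closedin X A \<and> \<not> A \<subseteq> C}"
  unfolding vietoris_def by (rule topology_generated_by_Basis) blast

text \<open>This closed set and the next one serve as parameters of subbasic open sets of the double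
  Vietoris space, for the continuity of union.\<close>

lemma closedin_vietoris_meets:
  assumes "closedin X C"
  shows "closedin (vietoris X) {A. closedin X A \<and> A \<inter> C \<noteq> {}}"
proof -
  have "{A. closedin X A \<and> A \<inter> C \<noteq> {}}
      = topspace (vietoris X) - {A. closedin X A \<and> A \<inter> C = {}}"
    by (auto simp: topspace_vietoris)
  then show ?thesis
    by (simp only: closedin_diff[OF closedin_topspace openin_vietoris_disjoint[OF assms]])
qed

lemma closedin_vietoris_subset:
  assumes "closedin X C"
  shows "closedin (vietoris X) {A. closedin X A \<and> A \<subseteq> C}"
proof -
  have "{A. closedin X A \<and> A \<subseteq> C} = topspace (vietoris X) - {A. closedin X A \<and> \<not> A \<subseteq> C}"
    by (auto simp: topspace_vietoris)
  then show ?thesis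
    by (simp only: closedin_diff[OF closedin_topspace openin_vietoris_not_subset[OF assms]])
qed

lemma continuous_map_into_vietoris:
  assumes "\<And>x. x \<in> topspace Z \<Longrightarrow> closedin X (g x)"
    and "\<And>C. closedin X C \<Longrightarrow> openin Z {x \<in> topspace Z. g x \<inter> C = {}}"
    and "\<And>C. closedin X C \<Longrightarrow> openin Z {x \<in> topspace Z. \<not> g x \<subseteq> C}"
  shows "continuous_map Z (vietoris X) g"
  unfolding vietoris_def
proof (rule continuous_on_generated_topo)
  let ?S = "(\<lambda>C. {A. closedin X A \<and> A \<inter> C = {}}) ` {C. closedin X C} \<union>
      (\<lambda>C. {A. closedin X A \<and> \<not> A \<subseteq> C}) ` {C. closedin X C}"
  show "openin Z (g -` U \<inter> topspace Z)" if "U \<in> ?S" for U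
  proof -
    have "g -` {A. closedin X A \<and> A \<inter> C = {}} \<inter> topspace Z = {x \<in> topspace Z. g x \<inter> C = {}}"
      "g -` {A. closedin X A \<and> \<not> A \<subseteq> C} \<inter> topspace Z = {x \<in> topspace Z. \<not> g x \<subseteq> C}" for C
      using assms(1) by auto
    then show ?thesis using that assms(2,3) by (elim UnE imageE) simp_all
  qed
  have "\<Union>?S = {A. closedin X A}"
    using topspace_vietoris[of X] by (simp add: vietoris_def topology_generated_by_topspace)
  then show "g ` topspace Z \<subseteq> \<Union>?S" using assms(1) by auto
qed

text \<open>Convergence can be tested on the subbasis, because the condition that a set containing
  \<open>L\<close> belongs to \<open>FF\<close> survives finite intersections and arbitrary
  unions.\<close>

lemma vietoris_convergesI:
  assumes FF: "FF \<in> beta (topspace (vietoris X))" and L: "closedin X L"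
    and disj: "\<And>C. closedin X C \<Longrightarrow> L \<inter> C = {} \<Longrightarrow> {A. closedin X A \<and> A \<inter> C = {}} \<in> FF"
    and nsub: "\<And>C. closedin X C \<Longrightarrow> \<not> L \<subseteq> C \<Longrightarrow> {A. closedin X A \<and> \<not> A \<subseteq> C} \<in> FF"
  shows "ultrafilter_converges (vietoris X) FF L"
proof -
  let ?S = "(\<lambda>C. {A. closedin X A \<and> A \<inter> C = {}}) ` {C. closedin X C} \<union>
      (\<lambda>C. {A. closedin X A \<and> \<not> A \<subseteq> C}) ` {C. closedin X C}"
  note u = betaD[OF FF]
  have gen: "U \<in> FF" if "generate_topology_on ?S U" "L \<in> U" for U
    using that
  proof (induction rule: generate_topology_on.induct)
    case Empty
    then show ?case by simp
  next
    case (Int a b)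
    then show ?case using u(4) by blast
  next
    case (UN K)
    then obtain k where k: "k \<in> K" "L \<in> k" "k \<in> FF" by blast
    \<comment> \<open>Upward closure of \<open>FF\<close> holds only among subsets of the
      carrier.\<close>
    have "\<Union>K \<subseteq> topspace (vietoris X)"
      using generate_topology_on.UN[of K ?S] UN.hyps
      by (intro openin_subset) (simp add: vietoris_def openin_topology_generated_by_iff)
    then show ?case using u(5)[OF k(3)] k(1) by blast
  next
    case (Basis s)
    then show ?case using disj nsub by auto
  qed
  then show ?thesis
    using L by (simp add: ultrafilter_converges_def topspace_vietoris)
      (simp add: vietoris_def openin_topology_generated_by_iff)
qed

lemma closure_of_in_vietoris:
  "(closure_of) X \<in> Pow (topspace X) \<rightarrow> topspace (vietoris X)"
  by (simp add: topspace_vietoris)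

text \<open>Both kinds of subbasic neighbourhood are handled by contradiction: compactness of
  \<open>X\<close> settles the sets missing \<open>C\<close>, and a single member of
  \<open>FF\<close> settles those not contained in \<open>C\<close>.\<close>

lemma vietoris_converges_pow_limit:
  assumes X: "compact_space X" and FF: "FF \<in> beta (Pow (topspace X))"
  shows "ultrafilter_converges (vietoris X)
    (beta_map (Pow (topspace X)) (topspace (vietoris X)) ((closure_of) X) FF) (pow_limit X FF)"
proof (rule vietoris_convergesI[OF beta_map_in_beta[OF closure_of_in_vietoris FF] closedin_pow_limit])
  note u = betaD[OF FF]
  fix C assume C: "closedin X C"
  show "{A. closedin X A \<and> A \<inter> C = {}}
      \<in> beta_map (Pow (topspace X)) (topspace (vietoris X)) ((closure_of) X) FF"
    if disj: "pow_limit X FF \<inter> C = {}"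
  proof (rule ccontr)
    let ?D = "{B \<in> Pow (topspace X). (X closure_of B) \<inter> C = {}}"
    assume "\<not> ?thesis"
    then have "?D \<notin> FF" by (auto simp: beta_map_def topspace_vietoris)
    then have D: "Pow (topspace X) - ?D \<in> FF" by (intro u(6)) auto
    \<comment> \<open>A common point of this family of closed sets would lie in both
      \<open>pow_limit X FF\<close> and \<open>C\<close>.\<close>
    let ?K = "insert C ((\<lambda>\<A>. X closure_of \<Union>\<A>) ` FF)"
    have fip: "\<Inter>H \<noteq> {}" if H: "finite H" "H \<subseteq> ?K" for H
    proof -
      obtain I where I: "finite I" "I \<subseteq> FF" "H - {C} \<subseteq> (\<lambda>\<A>. X closure_of \<Union>\<A>) ` I"
      proof -
        have "finite (H - {C})" "H - {C} \<subseteq> (\<lambda>\<A>. X closure_of \<Union>\<A>) ` FF" using H by auto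
        from finite_subset_image[OF this] show ?thesis using that by auto
      qed
      \<comment> \<open>A set \<open>B\<close> in this intersection belongs to each of the finitely
        many members in \<open>I\<close>, and its closure meets \<open>C\<close>. That closure lies
        below all the closures involved, so its points in \<open>C\<close> lie in
        \<open>\<Inter>H\<close>.\<close>
      have "Pow (topspace X) \<inter> \<Inter>(insert (Pow (topspace X) - ?D) I) \<in> FF"
        by (rule beta_Inter[OF FF]) (use I D in auto)
      then obtain B where "B \<in> Pow (topspace X) \<inter> \<Inter>(insert (Pow (topspace X) - ?D) I)"
        by (rule beta_memberE[OF FF])
      then have B: "B \<subseteq> topspace X" "(X closure_of B) \<inter> C \<noteq> {}" "\<forall>\<A>\<in>I. B \<in> \<A>"
        by simp_all
      have "(X closure_of B) \<subseteq> X closure_of \<Union>\<A>" if "\<A> \<in> I" for \<A>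
        using that B(3) by (intro closure_of_mono) blast
      then have "(X closure_of B) \<inter> C \<subseteq> \<Inter>H" using I(3) by blast
      then show ?thesis using B(2) by blast
    qed
    have "closedin X K" if "K \<in> ?K" for K using that C by auto
    then have "\<Inter>?K \<noteq> {}" using fip by (rule compact_space_Inter_nonempty[OF X])
    then show False using disj closedin_subset[OF C] by (auto simp: pow_limit_def)
  qed
  show "{A. closedin X A \<and> \<not> A \<subseteq> C}
      \<in> beta_map (Pow (topspace X)) (topspace (vietoris X)) ((closure_of) X) FF"
    if nsub: "\<not> pow_limit X FF \<subseteq> C"
  proof (rule ccontr)
    let ?D = "{B \<in> Pow (topspace X). \<not> (X closure_of B) \<subseteq> C}"
    assume "\<not> ?thesis"
    then have "?D \<notin> FF" by (auto simp: beta_map_def topspace_vietoris)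
    then have D: "Pow (topspace X) - ?D \<in> FF" by (intro u(6)) auto
    \<comment> \<open>The complement of \<open>?D\<close> is itself one of the members over which
      \<open>pow_limit\<close> intersects, and its union stays within the closed set
      \<open>C\<close>.\<close>
    have "B \<subseteq> C" if "B \<in> Pow (topspace X) - ?D" for B
      using that closure_of_subset[of B X] by auto
    then have "\<Union>(Pow (topspace X) - ?D) \<subseteq> C" by (rule Union_least)
    then have "X closure_of \<Union>(Pow (topspace X) - ?D) \<subseteq> C"
      using C by (rule closure_of_minimal)
    then show False using nsub D unfolding pow_limit_def by blast
  qed
qed

text \<open>Closure fixes closed sets, so every ultrafilter on the Vietoris space is the pushforward
  along closure of an ultrafilter on the power set. This makes the convergence result apply to all
  of them.\<close>

lemma beta_map_closure_of_inclusion: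
  assumes F: "F \<in> beta (topspace (vietoris X))"
  shows "beta_map (topspace (vietoris X)) (Pow (topspace X)) (\<lambda>B. B) F \<in> beta (Pow (topspace X))"
    and "beta_map (Pow (topspace X)) (topspace (vietoris X)) ((closure_of) X)
      (beta_map (topspace (vietoris X)) (Pow (topspace X)) (\<lambda>B. B) F) = F"
proof -
  have incl: "(\<lambda>B. B) \<in> topspace (vietoris X) \<rightarrow> Pow (topspace X)"
    using closedin_subset by (auto simp: topspace_vietoris)
  show "beta_map (topspace (vietoris X)) (Pow (topspace X)) (\<lambda>B. B) F \<in> beta (Pow (topspace X))"
    by (rule beta_map_in_beta[OF incl F])
  have "beta_map (topspace (vietoris X)) (topspace (vietoris X)) ((closure_of) X) F
      = beta_map (topspace (vietoris X)) (topspace (vietoris X)) (\<lambda>B. B) F"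
    by (rule beta_map_cong) (simp add: topspace_vietoris closure_of_closedin)
  then show "beta_map (Pow (topspace X)) (topspace (vietoris X)) ((closure_of) X)
      (beta_map (topspace (vietoris X)) (Pow (topspace X)) (\<lambda>B. B) F) = F"
    by (simp add: beta_map_comp[OF incl] beta_map_ident[OF F])
qed

section \<open>The Vietoris space is compact Hausdorff and carries the lifted algebra\<close>

lemma compact_space_vietoris:
  assumes "compact_space X"
  shows "compact_space (vietoris X)"
proof (rule compact_space_if_ultrafilters_converge)
  show "\<exists>L. ultrafilter_converges (vietoris X) F L" if "F \<in> beta (topspace (vietoris X))" for F
    using vietoris_converges_pow_limit[OF assms beta_map_closure_of_inclusion(1)[OF that]]
    unfolding beta_map_closure_of_inclusion(2)[OF that] by blast
qed

text \<open>Regularity separates a point \<open>x\<close> of \<open>A\<close> outside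
  \<open>B\<close> from \<open>B\<close> by disjoint open sets \<open>U\<close> and
  \<open>W\<close>. The closed sets meeting \<open>U\<close> and the closed sets inside
  \<open>W\<close> then form disjoint neighbourhoods of \<open>A\<close> and
  \<open>B\<close>.\<close>

lemma Hausdorff_space_vietoris:
  assumes "compact_space X" "Hausdorff_space X"
  shows "Hausdorff_space (vietoris X)"
proof -
  have sep: "\<exists>U V. openin (vietoris X) U \<and> openin (vietoris X) V \<and> A \<in> U \<and> B \<in> V \<and> disjnt U V"
    if A: "closedin X A" and B: "closedin X B" and x: "x \<in> A" "x \<notin> B" for A B x
  proof -
    have "x \<in> topspace X - B" using x closedin_subset[OF A] by blast
    then obtain U W where UW: "openin X U" "openin X W" "x \<in> U" "B \<subseteq> W" "disjnt U W"
      using compact_Hausdorff_imp_regular_space[OF assms] B unfolding regular_space_def by metis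
    let ?U = "{D. closedin X D \<and> \<not> D \<subseteq> topspace X - U}"
    let ?V = "{D. closedin X D \<and> D \<inter> (topspace X - W) = {}}"
    have "openin (vietoris X) ?U" "openin (vietoris X) ?V"
      using UW by (auto intro!: openin_vietoris_not_subset openin_vietoris_disjoint)
    moreover have "A \<in> ?U" "B \<in> ?V" using A B x UW by auto
    moreover have "disjnt ?U ?V"
      using UW(5) closedin_subset[of X] by (fastforce simp: disjnt_iff)
    ultimately show ?thesis by blast
  qed
  show ?thesis unfolding Hausdorff_space_def topspace_vietoris
  proof (intro allI impI, elim conjE)
    fix A B assume "A \<in> {A. closedin X A}" "B \<in> {A. closedin X A}" "A \<noteq> B"
    then have A: "closedin X A" and B: "closedin X B" by auto
    consider x where "x \<in> A" "x \<notin> B" | x where "x \<in> B" "x \<notin> A" using \<open>A \<noteq> B\<close> by blast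
    then show "\<exists>U V. openin (vietoris X) U \<and> openin (vietoris X) V \<and> A \<in> U \<and> B \<in> V \<and> disjnt U V"
      by cases (use sep[OF A B] sep[OF B A] in \<open>metis disjnt_sym\<close>)+
  qed
qed

lemma manes_vietoris_closure:
  assumes "compact_space X" "Hausdorff_space X" "FF \<in> beta (Pow (topspace X))"
  shows "snd (manes_algebra (vietoris X))
    (beta_map (Pow (topspace X)) (topspace (vietoris X)) ((closure_of) X) FF) = pow_limit X FF"
  by (intro manes_algebra_eqI Hausdorff_space_vietoris beta_map_in_beta
      vietoris_converges_pow_limit assms closure_of_in_vietoris)

lemma manes_vietoris_eq:
  assumes "compact_space X" "Hausdorff_space X" "F \<in> beta (topspace (vietoris X))"
  shows "snd (manes_algebra (vietoris X)) F
    = pow_limit X (beta_map (topspace (vietoris X)) (Pow (topspace X)) (\<lambda>B. B) F)"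
  using manes_vietoris_closure[OF assms(1,2) beta_map_closure_of_inclusion(1)[OF assms(3)]]
  by (simp add: beta_map_closure_of_inclusion(2)[OF assms(3)])

text \<open>The limit \<open>pow_limit\<close> is already closed, so the final projection, which is
  closure, leaves it unchanged; it is also the Vietoris limit.\<close>

lemma lift_obj_manes:
  assumes X: "compact_space X" "Hausdorff_space X"
  shows "lift_obj (manes_algebra X) = manes_algebra (vietoris X)"
proof (rule prod_eqI)
  show "fst (lift_obj (manes_algebra X)) = fst (manes_algebra (vietoris X))"
    using lift_carrier_manes[OF X] by (simp add: lift_obj_def)
  show "snd (lift_obj (manes_algebra X)) = snd (manes_algebra (vietoris X))"
  proof
    fix F
    show "snd (lift_obj (manes_algebra X)) F = snd (manes_algebra (vietoris X)) F"
    proof (cases "F \<in> beta (topspace (vietoris X))")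
      case True
      let ?G = "beta_map (topspace (vietoris X)) (Pow (topspace X)) (\<lambda>B. B) F"
      have "snd (lift_obj (manes_algebra X)) F = lift_proj (manes_algebra X) (pow_limit X ?G)"
        using True snd_pow_semialgebra_manes[OF X beta_map_closure_of_inclusion(1)[OF True]]
        by (simp add: lift_obj_def lift_carrier_manes[OF X] lift_incl_def)
      also have "\<dots> = pow_limit X ?G"
        using lift_proj_manes[OF X closedin_subset[OF closedin_pow_limit]]
        by (simp add: closure_of_closedin closedin_pow_limit)
      finally show ?thesis using manes_vietoris_eq[OF X True] by simp
    next
      \<comment> \<open>Both structure maps are restricted to ultrafilters and take the same default
        value elsewhere.\<close>
      case False
      then have "snd (manes_algebra (vietoris X)) F = undefined"
        by (simp add: manes_algebra_def)
      then show ?thesis using False by (simp add: lift_obj_def lift_carrier_manes[OF X])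
    qed
  qed
qed

section \<open>The splitting\<close>

lemma pow_limit_subset_topspace: "pow_limit X FF \<subseteq> topspace X"
  by (simp add: pow_limit_def)

text \<open>
  Since \<open>s = \<xi>\<^sub>V \<circ> \<beta>cl\<close>, where \<open>\<xi>\<^sub>V\<close> is the Vietoris algebra, associativity of \<open>s\<close> follows from
  that of \<open>\<xi>\<^sub>V\<close>: \<open>s \<circ> \<beta>s = \<xi>\<^sub>V \<circ> \<beta>(cl \<circ> s) = \<xi>\<^sub>V \<circ> \<beta>\<xi>\<^sub>V \<circ> \<beta>\<beta>cl = \<xi>\<^sub>V \<circ> \<mu> \<circ> \<beta>\<beta>cl = s \<circ> \<mu>\<close>.
\<close>

lemma beta_semialgebra_pow_manes:
  assumes X: "compact_space X" "Hausdorff_space X"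
  shows "beta_semialgebra (pow_semialgebra (manes_algebra X))"
proof -
  let ?P = "Pow (topspace X)" and ?V = "topspace (vietoris X)" and ?c = "(closure_of) X"
  let ?s = "snd (pow_semialgebra (manes_algebra X))" and ?v = "snd (manes_algebra (vietoris X))"
  note c = closure_of_in_vietoris[of X]
  note s = snd_pow_semialgebra_manes[OF X]
  have sv: "?s FF = ?v (beta_map ?P ?V ?c FF)" if "FF \<in> beta ?P" for FF
    by (simp add: s[OF that] manes_vietoris_closure[OF X that])
  have fn: "?s \<in> beta ?P \<rightarrow> ?P" using s pow_limit_subset_topspace by fastforce
  have v: "?v \<in> beta ?V \<rightarrow> ?V"
    using manes_algebra_in_topspace compact_space_vietoris Hausdorff_space_vietoris X by blast
  have "?s (beta_map (beta ?P) ?P ?s \<Phi>) = ?s (beta_mult ?P \<Phi>)" if \<Phi>: "\<Phi> \<in> beta (beta ?P)" for \<Phi>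
  proof -
    have bc: "beta_map ?P ?V ?c \<in> beta ?P \<rightarrow> beta ?V" using beta_map_in_beta[OF c] by blast
    have "?s (beta_map (beta ?P) ?P ?s \<Phi>)
        = ?v (beta_map (beta ?P) ?V (\<lambda>FF. X closure_of (?s FF)) \<Phi>)"
      by (simp add: sv[OF beta_map_in_beta[OF fn \<Phi>]] beta_map_comp[OF fn])
    also have "beta_map (beta ?P) ?V (\<lambda>FF. X closure_of (?s FF)) \<Phi>
        = beta_map (beta ?P) ?V (\<lambda>FF. ?v (beta_map ?P ?V ?c FF)) \<Phi>"
      by (rule beta_map_cong)
        (simp add: s manes_vietoris_closure[OF X] closure_of_closedin closedin_pow_limit)
    also have "\<dots> = beta_map (beta ?V) ?V ?v (beta_map (beta ?P) (beta ?V) (beta_map ?P ?V ?c) \<Phi>)"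
      by (simp add: beta_map_comp[OF bc])
    also have "?v \<dots> = ?v (beta_mult ?V (beta_map (beta ?P) (beta ?V) (beta_map ?P ?V ?c) \<Phi>))"
      using beta_semialgebra_manes[OF compact_space_vietoris[OF X(1)] Hausdorff_space_vietoris[OF X]]
        beta_map_in_beta[OF bc \<Phi>]
      by (simp add: beta_semialgebra_def case_prod_beta)
    also have "\<dots> = ?s (beta_mult ?P \<Phi>)"
      by (simp add: beta_mult_natural[OF c] sv[OF beta_mult_in_beta[OF \<Phi>]])
    finally show ?thesis .
  qed
  then show ?thesis using fn by (simp add: beta_semialgebra_def case_prod_beta)
qed

lemma semialgebra_map_comp:
  assumes f: "semialgebra_map SA SB f" and g: "semialgebra_map SB SC g"
  shows "semialgebra_map SA SC (\<lambda>x. g (f x))"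
proof -
  have fn: "f \<in> fst SA \<rightarrow> fst SB" using f by (simp add: semialgebra_map_def case_prod_beta)
  have "snd SC (beta_map (fst SA) (fst SC) (\<lambda>x. g (f x)) F) = g (f (snd SA F))"
    if F: "F \<in> beta (fst SA)" for F
  proof -
    have "snd SB (beta_map (fst SA) (fst SB) f F) = f (snd SA F)"
      using f F by (simp add: semialgebra_map_def case_prod_beta)
    moreover have "snd SC (beta_map (fst SB) (fst SC) g (beta_map (fst SA) (fst SB) f F))
        = g (snd SB (beta_map (fst SA) (fst SB) f F))"
      using g beta_map_in_beta[OF fn F] by (simp add: semialgebra_map_def case_prod_beta)
    ultimately show ?thesis by (simp add: beta_map_comp[OF fn])
  qed
  then show ?thesis using f g
    by (auto simp: semialgebra_map_def case_prod_beta Pi_iff)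
qed

text \<open>The semialgebra hypothesis keeps the values of the structure map in the carrier, where
  \<open>f\<close> and \<open>g\<close> agree.\<close>

lemma semialgebra_map_cong:
  assumes "semialgebra_map SA SB f" "\<And>x. x \<in> fst SA \<Longrightarrow> f x = g x"
    and "beta_semialgebra SA"
  shows "semialgebra_map SA SB g"
  using assms beta_map_cong[of "fst SA" f g "fst SB"]
  by (auto simp: semialgebra_map_def beta_semialgebra_def case_prod_beta Pi_iff)

lemma is_splitting_manes:
  assumes X: "compact_space X" "Hausdorff_space X"
  shows "is_splitting (pow_semialgebra (manes_algebra X)) (pow_idem (manes_algebra X))
    (manes_algebra (vietoris X)) (lift_incl (manes_algebra X)) (lift_proj (manes_algebra X))"
proof -
  let ?P = "pow_semialgebra (manes_algebra X)" and ?V = "manes_algebra (vietoris X)"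
  let ?i = "lift_incl (manes_algebra X)" and ?p = "lift_proj (manes_algebra X)"
  have P: "beta_semialgebra ?P" by (rule beta_semialgebra_pow_manes[OF X])
  have i: "semialgebra_map ?V ?P ?i"
    unfolding semialgebra_map_def case_prod_beta
    using closedin_subset[of X] manes_vietoris_eq[OF X]
      snd_pow_semialgebra_manes[OF X beta_map_closure_of_inclusion(1)]
    by (auto simp: lift_incl_def topspace_vietoris)
  \<comment> \<open>The Vietoris limit of the closures is \<open>pow_limit\<close>, which equals its
    own closure.\<close>
  have "semialgebra_map ?P ?V ((closure_of) X)"
    unfolding semialgebra_map_def case_prod_beta
    using closure_of_in_vietoris[of X] manes_vietoris_closure[OF X] snd_pow_semialgebra_manes[OF X]
    by (auto simp: closure_of_closedin closedin_pow_limit)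
  then have p: "semialgebra_map ?P ?V ?p"
    by (rule semialgebra_map_cong) (auto simp: lift_proj_manes[OF X] P)
  \<comment> \<open>The idempotent is the composite of the two halves, so it inherits compatibility
    with the structure from them.\<close>
  have "semialgebra_map ?P ?P (\<lambda>B. ?i (?p B))" by (rule semialgebra_map_comp[OF p i])
  then have e: "semialgebra_map ?P ?P (pow_idem (manes_algebra X))"
    by (simp add: lift_incl_def lift_proj_def)
  have idem: "idempotent_endo ?P (pow_idem (manes_algebra X))"
    using e by (auto simp: idempotent_endo_def pow_idem_manes[OF X] closure_of_subset_topspace)
  have pi: "?p (?i B) = B" if "B \<in> fst ?V" for B
    using that closedin_subset[of X B]
    by (simp add: lift_incl_def topspace_vietoris lift_proj_manes[OF X] closure_of_closedin)
  show ?thesis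
    unfolding is_splitting_def
    using P i p idem pi
      beta_semialgebra_manes[OF compact_space_vietoris[OF X(1)] Hausdorff_space_vietoris[OF X]]
    by (simp add: lift_incl_def lift_proj_def)
qed

section \<open>Action on maps, unit and multiplication\<close>

text \<open>Direct images are closed because a continuous map from a compact to a Hausdorff space is
  closed. Missing \<open>C\<close>, or lying in \<open>C\<close>, translates into the same relation
  to the preimage of \<open>C\<close>, so subbasic sets pull back to subbasic sets.\<close>

lemma continuous_map_vietoris_map:
  assumes X: "compact_space X" and Y: "Hausdorff_space Y" and f: "continuous_map X Y f"
  shows "continuous_map (vietoris X) (vietoris Y) (vietoris_map f)"
proof (rule continuous_map_into_vietoris)
  show "closedin Y (vietoris_map f A)" if "A \<in> topspace (vietoris X)" for A
    using that continuous_imp_closed_map[OF f X Y]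
    by (simp add: closed_map_def vietoris_map_def topspace_vietoris)
next
  fix C assume C: "closedin Y C"
  have pre: "closedin X {x \<in> topspace X. f x \<in> C}"
    by (rule closedin_continuous_map_preimage[OF f C])
  have "{A \<in> topspace (vietoris X). vietoris_map f A \<inter> C = {}}
      = {A. closedin X A \<and> A \<inter> {x \<in> topspace X. f x \<in> C} = {}}"
    using closedin_subset[of X] by (fastforce simp: vietoris_map_def topspace_vietoris)
  then show "openin (vietoris X) {A \<in> topspace (vietoris X). vietoris_map f A \<inter> C = {}}"
    using openin_vietoris_disjoint[OF pre] by simp
  have "{A \<in> topspace (vietoris X). \<not> vietoris_map f A \<subseteq> C}
      = {A. closedin X A \<and> \<not> A \<subseteq> {x \<in> topspace X. f x \<in> C}}"
    using closedin_subset[of X] by (fastforce simp: vietoris_map_def topspace_vietoris)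
  then show "openin (vietoris X) {A \<in> topspace (vietoris X). \<not> vietoris_map f A \<subseteq> C}"
    using openin_vietoris_not_subset[OF pre] by simp
qed

lemma closedin_singleton_Hausdorff:
  "Hausdorff_space X \<Longrightarrow> x \<in> topspace X \<Longrightarrow> closedin X {x}"
  by (simp add: Hausdorff_imp_t1_space closedin_t1_singleton)

lemma continuous_map_vietoris_unit:
  assumes "Hausdorff_space X"
  shows "continuous_map X (vietoris X) vietoris_unit"
proof (rule continuous_map_into_vietoris)
  show "closedin X (vietoris_unit x)" if "x \<in> topspace X" for x
    using closedin_singleton_Hausdorff[OF assms that] by (simp add: vietoris_unit_def)
next
  fix C assume "closedin X C"
  then have op: "openin X (topspace X - C)" by blast
  have "{x \<in> topspace X. vietoris_unit x \<inter> C = {}} = topspace X - C"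
    "{x \<in> topspace X. \<not> vietoris_unit x \<subseteq> C} = topspace X - C"
    by (auto simp: vietoris_unit_def)
  then show "openin X {x \<in> topspace X. vietoris_unit x \<inter> C = {}}"
    "openin X {x \<in> topspace X. \<not> vietoris_unit x \<subseteq> C}" using op by simp_all
qed

text \<open>The family \<open>\<A>\<close> is compact in the Vietoris space. Given \<open>x\<close>
  outside its union, each member \<open>B\<close> is separated from \<open>x\<close> by open sets
  \<open>U B\<close> and \<open>W B\<close>; finitely many of the sets \<open>W B\<close> are enough
  to enclose every member, and the matching \<open>U B\<close> intersect in a neighbourhood of
  \<open>x\<close> missing the union.\<close>

lemma closedin_Union_vietoris:
  assumes X: "compact_space X" "Hausdorff_space X" and \<A>: "closedin (vietoris X) \<A>"
  shows "closedin X (\<Union>\<A>)"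
proof -
  have cl: "closedin X B" if "B \<in> \<A>" for B
    using closedin_subset[OF \<A>] that by (auto simp: topspace_vietoris)
  have separated: "\<exists>U. openin X U \<and> x \<in> U \<and> U \<inter> \<Union>\<A> = {}" if x: "x \<in> topspace X" "x \<notin> \<Union>\<A>" for x
  proof -
    have "\<exists>U W. openin X U \<and> openin X W \<and> x \<in> U \<and> B \<subseteq> W \<and> disjnt U W" if "B \<in> \<A>" for B
    proof -
      have "x \<in> topspace X - B" using x that by blast
      then show ?thesis
        using compact_Hausdorff_imp_regular_space[OF X] cl[OF that]
        unfolding regular_space_def by metis
    qed
    then obtain U W where UW: "\<And>B. B \<in> \<A> \<Longrightarrow> openin X (U B) \<and> openin X (W B) \<and>
        x \<in> U B \<and> B \<subseteq> W B \<and> disjnt (U B) (W B)" by metis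
    define N where "N B = {A. closedin X A \<and> A \<inter> (topspace X - W B) = {}}" for B
    have "compactin (vietoris X) \<A>"
      by (rule closedin_compact_space[OF compact_space_vietoris[OF X(1)] \<A>])
    moreover have "openin (vietoris X) T" if "T \<in> N ` \<A>" for T
      using that UW unfolding N_def by (auto intro!: openin_vietoris_disjoint)
    moreover have "\<A> \<subseteq> \<Union>(N ` \<A>)" using cl UW by (fastforce simp: N_def)
    ultimately obtain \<F> where \<F>: "finite \<F>" "\<F> \<subseteq> N ` \<A>" "\<A> \<subseteq> \<Union>\<F>"
      by (meson compactinD)
    then obtain I where I: "finite I" "I \<subseteq> \<A>" "\<F> = N ` I" using finite_subset_image by metis
    \<comment> \<open>The whole space is inserted so that the intersection is open also when
      \<open>I\<close> is empty.\<close>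
    let ?U = "\<Inter>(insert (topspace X) (U ` I))"
    have "openin X ?U" using I UW by (intro openin_Inter) auto
    moreover have "x \<in> ?U" using x I UW by auto
    moreover have "?U \<inter> \<Union>\<A> = {}"
    proof (rule ccontr)
      assume "?U \<inter> \<Union>\<A> \<noteq> {}"
      then obtain y B where y: "y \<in> ?U" "y \<in> B" "B \<in> \<A>" by blast
      then obtain J where J: "J \<in> I" "B \<in> N J" using \<F>(3) I(3) by blast
      then have "y \<in> U J" "y \<in> W J" using y by (auto simp: N_def)
      then show False using UW[of J] J(1) I(2) by (auto simp: disjnt_iff)
    qed
    ultimately show ?thesis by blast
  qed
  have "\<exists>U. openin X U \<and> x \<in> U \<and> U \<subseteq> topspace X - \<Union>\<A>" if "x \<in> topspace X - \<Union>\<A>" for x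
  proof -
    obtain U where U: "openin X U" "x \<in> U" "U \<inter> \<Union>\<A> = {}"
      using separated[of x] \<open>x \<in> topspace X - \<Union>\<A>\<close> by auto
    then have "U \<subseteq> topspace X - \<Union>\<A>" using openin_subset[OF U(1)] by blast
    then show ?thesis using U by metis
  qed
  then have "openin X (topspace X - \<Union>\<A>)" by (subst openin_subopen) blast
  moreover have "\<Union>\<A> \<subseteq> topspace X" by (rule Union_least) (rule closedin_subset[OF cl])
  ultimately show ?thesis by (simp add: closedin_def)
qed

text \<open>A union misses \<open>C\<close> iff no member meets \<open>C\<close>, and lies in
  \<open>C\<close> iff every member does. Both conditions compare the family with a closed subset of
  the Vietoris space, so they describe subbasic sets and their complements one level up.\<close>

lemma continuous_map_vietoris_mult:
  assumes X: "compact_space X" "Hausdorff_space X"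
  shows "continuous_map (vietoris (vietoris X)) (vietoris X) vietoris_mult"
proof (rule continuous_map_into_vietoris)
  show "closedin X (vietoris_mult \<A>)" if "\<A> \<in> topspace (vietoris (vietoris X))" for \<A>
    using that closedin_Union_vietoris[OF X] by (simp add: topspace_vietoris vietoris_mult_def)
next
  fix C assume C: "closedin X C"
  have sub: "B \<in> \<A> \<Longrightarrow> closedin X B" if "closedin (vietoris X) \<A>" for \<A> B
    using closedin_subset[OF that] by (auto simp: topspace_vietoris)
  have "{\<A> \<in> topspace (vietoris (vietoris X)). vietoris_mult \<A> \<inter> C = {}}
      = {\<A>. closedin (vietoris X) \<A> \<and> \<A> \<inter> {B. closedin X B \<and> B \<inter> C \<noteq> {}} = {}}"
    using sub unfolding topspace_vietoris vietoris_mult_def by blast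
  then show "openin (vietoris (vietoris X))
      {\<A> \<in> topspace (vietoris (vietoris X)). vietoris_mult \<A> \<inter> C = {}}"
    using openin_vietoris_disjoint[OF closedin_vietoris_meets[OF C]] by simp
  have "{\<A> \<in> topspace (vietoris (vietoris X)). \<not> vietoris_mult \<A> \<subseteq> C}
      = {\<A>. closedin (vietoris X) \<A> \<and> \<not> \<A> \<subseteq> {B. closedin X B \<and> B \<subseteq> C}}"
    using sub unfolding topspace_vietoris vietoris_mult_def by blast
  then show "openin (vietoris (vietoris X))
      {\<A> \<in> topspace (vietoris (vietoris X)). \<not> vietoris_mult \<A> \<subseteq> C}"
    using openin_vietoris_not_subset[OF closedin_vietoris_subset[OF C]] by simp
qed

text \<open>This is the compatibility of the projections with multiplication. The closed subsets of
  the closure of \<open>\<Union>\<A>\<close> form a Vietoris-closed set, which gives one inclusion;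
  closedness of unions of Vietoris-closed families gives the other.\<close>

lemma Union_vietoris_closure_of:
  assumes X: "compact_space X" "Hausdorff_space X" and \<A>: "\<A> \<subseteq> Pow (topspace X)"
  shows "\<Union>(vietoris X closure_of ((closure_of) X ` \<A>)) = X closure_of \<Union>\<A>"
proof
  have "vietoris X closure_of ((closure_of) X ` \<A>)
      \<subseteq> {B. closedin X B \<and> B \<subseteq> X closure_of \<Union>\<A>}"
    by (intro closure_of_minimal closedin_vietoris_subset) (auto intro!: closure_of_mono)
  then show "\<Union>(vietoris X closure_of ((closure_of) X ` \<A>)) \<subseteq> X closure_of \<Union>\<A>" by blast
  have "(closure_of) X ` \<A> \<subseteq> vietoris X closure_of ((closure_of) X ` \<A>)"
    by (rule closure_of_subset) (auto simp: topspace_vietoris)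
  moreover have "B \<subseteq> X closure_of B" if "B \<in> \<A>" for B
    using that \<A> by (intro closure_of_subset) auto
  ultimately have "\<Union>\<A> \<subseteq> \<Union>(vietoris X closure_of ((closure_of) X ` \<A>))" by blast
  then show "X closure_of \<Union>\<A> \<subseteq> \<Union>(vietoris X closure_of ((closure_of) X ` \<A>))"
    by (rule closure_of_minimal) (rule closedin_Union_vietoris[OF X closedin_closure_of])
qed

lemma is_lift_map_vietoris:
  assumes X: "compact_space X" "Hausdorff_space X" and Y: "compact_space Y" "Hausdorff_space Y"
    and f: "continuous_map X Y f"
  shows "is_lift_map (manes_algebra X) (manes_algebra Y) f (vietoris_map f)"
proof -
  \<comment> \<open>Naturality of the projection amounts to \<open>f\<close> commuting with closure:
    one inclusion holds because \<open>f\<close> is a closed map, the other by continuity.\<close>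
  have "Y closure_of (f ` B) = f ` (X closure_of B)" if "B \<subseteq> topspace X" for B
  proof
    show "Y closure_of (f ` B) \<subseteq> f ` (X closure_of B)"
      using continuous_imp_closed_map[OF f X(1) Y(2)] that
      by (simp add: closed_map_closure_of_image)
    show "f ` (X closure_of B) \<subseteq> Y closure_of (f ` B)"
      by (rule continuous_map_image_closure_subset[OF f])
  qed
  moreover have "f ` B \<subseteq> topspace Y" if "B \<subseteq> topspace X" for B
    using that continuous_map_image_subset_topspace[OF f] by blast
  ultimately show ?thesis
    unfolding is_lift_map_def lift_obj_manes[OF X] lift_obj_manes[OF Y]
    using semialgebra_map_manes[OF compact_space_vietoris[OF X(1)] Hausdorff_space_vietoris[OF X]
        Hausdorff_space_vietoris[OF Y] continuous_map_vietoris_map[OF X(1) Y(2) f]]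
    by (simp add: lift_incl_def lift_proj_manes[OF X] lift_proj_manes[OF Y] vietoris_map_def)
qed

lemma is_lift_unit_vietoris:
  assumes X: "compact_space X" "Hausdorff_space X"
  shows "is_lift_unit (manes_algebra X) vietoris_unit"
  unfolding is_lift_unit_def lift_obj_manes[OF X]
  using semialgebra_map_manes[OF X Hausdorff_space_vietoris[OF X]
      continuous_map_vietoris_unit[OF X(2)]] closedin_singleton_Hausdorff[OF X(2)]
  by (simp add: lift_incl_def lift_proj_manes[OF X] vietoris_unit_def closure_of_closedin)

lemma is_lift_mult_vietoris:
  assumes X: "compact_space X" "Hausdorff_space X"
  shows "is_lift_mult (manes_algebra X) vietoris_mult"
proof -
  note V = compact_space_vietoris[OF X(1)] Hausdorff_space_vietoris[OF X]
  note VV = compact_space_vietoris[OF V(1)] Hausdorff_space_vietoris[OF V]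
  have "vietoris_mult (lift_proj (manes_algebra (vietoris X)) (lift_proj (manes_algebra X) ` \<A>))
      = lift_proj (manes_algebra X) (\<Union>\<A>)" if \<A>: "\<A> \<subseteq> Pow (topspace X)" for \<A>
  proof -
    \<comment> \<open>The projection is known to be closure only on subsets of the space, hence the
      rewriting within the image of \<open>\<A>\<close>.\<close>
    have im: "lift_proj (manes_algebra X) ` \<A> = (closure_of) X ` \<A>"
      using \<A> by (intro image_cong refl lift_proj_manes[OF X]) auto
    have "(closure_of) X ` \<A> \<subseteq> topspace (vietoris X)" by (auto simp: topspace_vietoris)
    moreover have "\<Union>\<A> \<subseteq> topspace X" using \<A> by blast
    ultimately show ?thesis
      by (simp add: im lift_proj_manes[OF X] lift_proj_manes[OF V] vietoris_mult_def
          Union_vietoris_closure_of[OF X \<A>])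
  qed
  then show ?thesis
    unfolding is_lift_mult_def lift_obj_manes[OF X] lift_obj_manes[OF V]
    using semialgebra_map_manes[OF VV V(2) continuous_map_vietoris_mult[OF X]]
    by (auto simp: lift_incl_def vietoris_mult_def)
qed

theorem theorem20:
  fixes X :: "'a topology" and Y :: "'b topology" and f :: "'a \<Rightarrow> 'b"
  assumes "compact_space X" and "Hausdorff_space X"
    and "compact_space Y" and "Hausdorff_space Y"
    and "continuous_map X Y f"
  shows "is_splitting (pow_semialgebra (manes_algebra X)) (pow_idem (manes_algebra X))
           (lift_obj (manes_algebra X)) (lift_incl (manes_algebra X)) (lift_proj (manes_algebra X)) \<and>
         compact_space (vietoris X) \<and> Hausdorff_space (vietoris X) \<and>
         lift_obj (manes_algebra X) = manes_algebra (vietoris X) \<and>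
         is_lift_map (manes_algebra X) (manes_algebra Y) f (vietoris_map f) \<and>
         is_lift_unit (manes_algebra X) vietoris_unit \<and>
         is_lift_mult (manes_algebra X) vietoris_mult"
  using is_splitting_manes[OF assms(1,2)] compact_space_vietoris[OF assms(1)]
    Hausdorff_space_vietoris[OF assms(1,2)] lift_obj_manes[OF assms(1,2)]
    is_lift_map_vietoris[OF assms] is_lift_unit_vietoris[OF assms(1,2)]
    is_lift_mult_vietoris[OF assms(1,2)]
  by simp

end
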